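(* Let $(\mathcal{G}_1,e_1,f_1)$ and $(\mathcal{G}_2,e_2,f_2)$ be birooted graphs, let $\mu_i$ be the spectral distribution of $(\mathcal{G}_i,e_i)$ and $\nu_i$ the spectral distribution of $(\mathcal{G}_i,f_i)$, $i=1,2$. Then the spectral distribution of the c-comb product $(\mathcal{G},e,f)$ of $(\mathcal{G}_1,e_1,f_1)$ and $(\mathcal{G}_2,e_2,f_2)$ is the pair $(\mu,\nu)$, where $$\mu=\mu_1\vartriangleright_{\nu_2}\mu_2\qquad\text{and}\qquad \nu=\nu_1\vartriangleright\nu_2 .$$
   Context: Graphs are non-oriented, uniformly locally finite (vertex degrees uniformly bounded), possibly disconnected with finitely many components, and may have loops. A birooted graph $(\mathcal{G},e,f)$ is a graph with two distinguished vertices $e,f$ (roots; allowed to coincide). The adjacency matrix $a(\mathcal{G})$ acts on $\ell^2(V)$ ($V$ the vertex set) and its $(x,y)$ entry is the number of edges joining $x$ and $y$ (each loop counted once). The spectral distribution of a rooted graph $(\mathcal{G},e)$ is the distribution with moments $M_n=\langle a(\mathcal{G})^n\delta(e),\delta(e)\rangle$, where $\delta(e)$ is the basis vector at $e$. The spectral distribution of a birooted graph $(\mathcal{G},e,f)$ is the pair of spectral distributions of $(\mathcal{G},e)$ and $(\mathcal{G},f)$. The comb product $(\mathcal{G}_1,f_1)\vartriangleright(\mathcal{G}_2,f_2)$ is obtained by attaching (gluing) a copy of $\mathcal{G}_2$ by its vertex $f_2$ to each vertex of $\mathcal{G}_1$; its root $f$ is the vertex obtained by identifying $f_1$ with $f_2$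 in the copy attached there. The graph $(\mathcal{G}_1,e_1)\vartriangleright_{f_2}(\mathcal{G}_2,e_2)$ is obtained by attaching a copy of $\mathcal{G}_2$ by $e_2$ to the root $e_1$ of $\mathcal{G}_1$ and a copy of $\mathcal{G}_2$ by $f_2$ to each of the remaining vertices of $\mathcal{G}_1$; its root $e$ is the vertex obtained by identifying $e_1$ with $e_2$ in the copy attached there. All edges are kept in both constructions. The c-comb product is the disjoint union $$(\mathcal{G},e,f)=\big((\mathcal{G}_1,e_1)\vartriangleright_{f_2}(\mathcal{G}_2,e_2)\big)\oplus\big((\mathcal{G}_1,f_1)\vartriangleright(\mathcal{G}_2,f_2)\big),$$ with $e$ the root of the first summand and $f$ the root of the second. For a distribution $\mu$ with moments $M_n$, $G_\mu(z)=\sum_{n\ge0}M_nz^{-n-1}$ and $F_\mu(z)=1/G_\mu(z)$. The monotone additive convolution $\nu_1\vartriangleright\nu_2$ is defined by $F_{\nu_1\vartriangleright\nu_2}(z)=F_{\nu_1}(F_{\nu_2}(z))$, and the c-monotone additive convolution $\mu_1\vartriangleright_{\nu_2}\mu_2$ by $F_{\mu_1\vartriangleright_{\nu_2}\mu_2}(z)=F_{\mu_1}(F_{\nu_2}(z))+F_{\mu_2}(z)-F_{\nu_2}(z)$. *)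

theory Defs
  imports
    "HOL-Analysis.Infinite_Sum"
    "HOL-Analysis.Convex"
    "HOL-Computational_Algebra.Formal_Laurent_Series"
begin

section \<open>Graphs and birooted graphs\<close>

text \<open>Undirected graphs with loops. Gluing two vertices that both carry a loop produces a vertex
  with two loops, so edges are abstract objects, and multiple edges are possible. An edge \<open>k\<close> with
  \<open>ends G k = {x, y}\<close> joins \<open>x\<close> and \<open>y\<close>; it is a loop if \<open>x = y\<close>.\<close>

record ('v, 'k) mgraph =
  verts :: "'v set"
  edges :: "'k set"
  ends  :: "'k \<Rightarrow> 'v set"

definition wf_graph :: "('v, 'k) mgraph \<Rightarrow> bool" where
  "wf_graph G \<longleftrightarrow> (\<forall>k\<in>edges G. \<exists>x\<in>verts G. \<exists>y\<in>verts G. ends G k = {x, y})"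

definition uniformly_locally_finite :: "('v, 'k) mgraph \<Rightarrow> bool" where
  "uniformly_locally_finite G \<longleftrightarrow>
     (\<exists>D::nat. \<forall>x\<in>verts G. finite {k\<in>edges G. x \<in> ends G k} \<and> card {k\<in>edges G. x \<in> ends G k} \<le> D)"

definition connected_in :: "('v, 'k) mgraph \<Rightarrow> ('v \<times> 'v) set" where
  "connected_in G = {(x, y). x \<in> verts G \<and> y \<in> verts G \<and>
                             (x, y) \<in> {(u, v). \<exists>k\<in>edges G. ends G k = {u, v}}\<^sup>*}"

definition graph_components :: "('v, 'k) mgraph \<Rightarrow> 'v set set" where
  "graph_components G = verts G // connected_in G"

type_synonym ('v, 'k) birooted = "('v, 'k) mgraph \<times> 'v \<times> 'v"

definition birooted_graph :: "('v, 'k) birooted \<Rightarrow> bool" where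
  "birooted_graph = (\<lambda>(G, e, f). wf_graph G \<and> uniformly_locally_finite G \<and> finite (graph_components G)
                                 \<and> e \<in> verts G \<and> f \<in> verts G)"

section \<open>The adjacency matrix on the space of square summable functions\<close>

definition adj :: "('v, 'k) mgraph \<Rightarrow> 'v \<Rightarrow> 'v \<Rightarrow> nat" where
  "adj G x y = card {k\<in>edges G. ends G k = {x, y}}"

definition ell2 :: "'v set \<Rightarrow> ('v \<Rightarrow> complex) set" where
  "ell2 V = {\<psi>. (\<forall>x. x \<notin> V \<longrightarrow> \<psi> x = 0) \<and> (\<lambda>x. (norm (\<psi> x))\<^sup>2) summable_on V}"

definition ell2_inner :: "'v set \<Rightarrow> ('v \<Rightarrow> complex) \<Rightarrow> ('v \<Rightarrow> complex) \<Rightarrow> complex" where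
  "ell2_inner V \<phi> \<psi> = (\<Sum>\<^sub>\<infinity>x\<in>V. \<phi> x * cnj (\<psi> x))"

definition adj_op :: "('v, 'k) mgraph \<Rightarrow> ('v \<Rightarrow> complex) \<Rightarrow> ('v \<Rightarrow> complex)" where
  "adj_op G \<psi> = (\<lambda>x. if x \<in> verts G then \<Sum>\<^sub>\<infinity>y\<in>verts G. of_nat (adj G x y) * \<psi> y else 0)"

definition delta :: "'v \<Rightarrow> 'v \<Rightarrow> complex" where
  "delta e = (\<lambda>x. if x = e then 1 else 0)"

lemma delta_in_ell2:
  assumes "e \<in> V"
  shows "delta e \<in> ell2 V"
proof -
  have "(\<lambda>x. (norm (delta e x))\<^sup>2) summable_on V \<longleftrightarrow> (\<lambda>x. (norm (delta e x))\<^sup>2) summable_on {e}"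
    by (rule summable_on_cong_neutral) (use assms in \<open>auto simp: delta_def\<close>)
  then have "(\<lambda>x. (norm (delta e x))\<^sup>2) summable_on V"
    by simp
  with assms show ?thesis
    by (auto simp: ell2_def delta_def)
qed

text \<open>The adjacency matrix of a uniformly locally finite graph does act on square summable
  functions.\<close>

lemma adj_op_in_ell2:
  assumes ulf: "uniformly_locally_finite G" and psi: "\<psi> \<in> ell2 (verts G)"
  shows "adj_op G \<psi> \<in> ell2 (verts G)"
proof -
  let ?V = "verts G"
  obtain D :: nat where D: "\<And>x. x \<in> ?V \<Longrightarrow> finite {k\<in>edges G. x \<in> ends G k}"
      "\<And>x. x \<in> ?V \<Longrightarrow> card {k\<in>edges G. x \<in> ends G k} \<le> D"
    using ulf unfolding uniformly_locally_finite_def by blast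
  define I where "I x = {k\<in>edges G. x \<in> ends G k}" for x
  define N where "N x = {y\<in>?V. adj G x y \<noteq> 0}" for x
  have adj_sym: "adj G x y = adj G y x" for x y
    by (simp add: adj_def insert_commute)
  have adjD: "adj G x y \<le> D" if "x \<in> ?V" for x y
  proof -
    have "adj G x y \<le> card (I x)"
      unfolding adj_def I_def by (rule card_mono) (use D that in auto)
    then show ?thesis using D that I_def by (metis le_trans)
  qed
  have N: "finite (N x)" "card (N x) \<le> D" if x: "x \<in> ?V" for x
  proof -
    define g where "g y = (SOME k. k \<in> edges G \<and> ends G k = {x, y})" for y
    have g: "g y \<in> edges G \<and> ends G (g y) = {x, y}" if "y \<in> N x" for y
    proof -
      have "{k\<in>edges G. ends G k = {x, y}} \<noteq> {}"
        using that by (metis (mono_tags, lifting) N_def adj_def card.empty mem_Collect_eq)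
      then show ?thesis unfolding g_def by (metis (mono_tags, lifting) empty_Collect_eq someI_ex)
    qed
    have inj: "inj_on g (N x)"
    proof (rule inj_onI)
      fix y z assume "y \<in> N x" "z \<in> N x" "g y = g z"
      then have "{x, y} = {x, z}" using g by metis
      then show "y = z" by (auto simp: doubleton_eq_iff)
    qed
    have sub: "g ` N x \<subseteq> I x" using g by (auto simp: I_def)
    have fin: "finite (I x)" using D x by (simp add: I_def)
    show "finite (N x)" using inj sub fin by (metis finite_imageD finite_subset)
    have "card (N x) \<le> card (I x)" using inj sub fin by (rule card_inj_on_le)
    then show "card (N x) \<le> D" using D(2)[OF x] by (simp add: I_def)
  qed
  define w where "w y = (norm (\<psi> y))\<^sup>2" for y
  have w0: "w y \<ge> 0" for y by (simp add: w_def)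
  have wsum: "w summable_on ?V" using psi unfolding ell2_def w_def by blast
  have row: "adj_op G \<psi> x = (\<Sum>y\<in>N x. of_nat (adj G x y) * \<psi> y)" if x: "x \<in> ?V" for x
  proof -
    have "(\<Sum>\<^sub>\<infinity>y\<in>?V. of_nat (adj G x y) * \<psi> y) = (\<Sum>\<^sub>\<infinity>y\<in>N x. of_nat (adj G x y) * \<psi> y)"
      by (rule infsum_cong_neutral) (auto simp: N_def)
    then show ?thesis using x N(1)[OF x] by (simp add: adj_op_def)
  qed
  have bd: "(norm (adj_op G \<psi> x))\<^sup>2 \<le> real D ^ 3 * (\<Sum>y\<in>N x. w y)" if x: "x \<in> ?V" for x
  proof -
    have "norm (adj_op G \<psi> x) \<le> (\<Sum>y\<in>N x. real D * norm (\<psi> y))"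
      unfolding row[OF x]
      by (rule sum_norm_le) (use adjD[OF x] in \<open>simp add: norm_mult mult_right_mono\<close>)
    then have "(norm (adj_op G \<psi> x))\<^sup>2 \<le> (\<Sum>y\<in>N x. real D * norm (\<psi> y))\<^sup>2"
      by (rule power_mono) simp
    also have "\<dots> = (real D)\<^sup>2 * (\<Sum>y\<in>N x. norm (\<psi> y))\<^sup>2"
      by (simp add: sum_distrib_left[symmetric] power_mult_distrib)
    also have "(\<Sum>y\<in>N x. norm (\<psi> y))\<^sup>2 \<le> real (card (N x)) * (\<Sum>y\<in>N x. w y)"
      using Cauchy_Schwarz_ineq_sum[of "\<lambda>_. 1" "\<lambda>y. norm (\<psi> y)" "N x"] by (simp add: w_def)
    also have "\<dots> \<le> real D * (\<Sum>y\<in>N x. w y)"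
      using N(2)[OF x] by (intro mult_right_mono sum_nonneg) (auto simp: w0)
    finally show ?thesis by (simp add: mult_left_mono power3_eq_cube power2_eq_square mult.assoc)
  qed
  have "(\<lambda>x. (norm (adj_op G \<psi> x))\<^sup>2) summable_on ?V"
  proof (rule nonneg_bdd_above_summable_on)
    show "bdd_above (sum (\<lambda>x. (norm (adj_op G \<psi> x))\<^sup>2) ` {F. F \<subseteq> ?V \<and> finite F})"
    proof (rule bdd_aboveI2)
      fix F assume "F \<in> {F. F \<subseteq> ?V \<and> finite F}"
      then have F: "F \<subseteq> ?V" "finite F" by auto
      define U where "U = (\<Union>x\<in>F. N x)"
      have U: "finite U" "U \<subseteq> ?V" using F N(1) by (auto simp: U_def N_def)
      have "(\<Sum>x\<in>F. (norm (adj_op G \<psi> x))\<^sup>2) \<le> (\<Sum>x\<in>F. real D ^ 3 * (\<Sum>y\<in>N x. w y))"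
        by (rule sum_mono) (use bd F in auto)
      also have "\<dots> = real D ^ 3 * (\<Sum>x\<in>F. \<Sum>y\<in>N x. w y)"
        by (simp add: sum_distrib_left)
      also have "(\<Sum>x\<in>F. \<Sum>y\<in>N x. w y) = (\<Sum>x\<in>F. \<Sum>y | y \<in> U \<and> y \<in> N x. w y)"
        by (intro sum.cong refl) (auto simp: U_def)
      also have "\<dots> = (\<Sum>y\<in>U. \<Sum>x | x \<in> F \<and> y \<in> N x. w y)"
        by (rule sum.swap_restrict) (use F U in auto)
      also have "\<dots> \<le> (\<Sum>y\<in>U. real D * w y)"
      proof (rule sum_mono)
        fix y assume y: "y \<in> U"
        have "{x. x \<in> F \<and> y \<in> N x} \<subseteq> N y"
          using F by (auto simp: N_def adj_sym[of y])
        then have "card {x. x \<in> F \<and> y \<in> N x} \<le> D"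
          using N[of y] y U by (meson card_mono le_trans subsetD)
        then show "(\<Sum>x | x \<in> F \<and> y \<in> N x. w y) \<le> real D * w y"
          by (simp add: mult_right_mono w0)
      qed
      also have "\<dots> = real D * (\<Sum>y\<in>U. w y)" by (simp add: sum_distrib_left)
      also have "(\<Sum>y\<in>U. w y) \<le> infsum w ?V"
        by (rule finite_sum_le_infsum) (use wsum U w0 in auto)
      finally show "(\<Sum>x\<in>F. (norm (adj_op G \<psi> x))\<^sup>2) \<le> real D ^ 3 * (real D * infsum w ?V)"
        by (simp add: mult_left_mono)
    qed
  qed auto
  then show ?thesis by (simp add: ell2_def adj_op_def)
qed

section \<open>Distributions\<close>

text \<open>As usual in noncommutative probability, a distribution is a unital linear functional on
  polynomials. It amounts to its sequence of moments.\<close>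

typedef distribution =
  "{\<phi> :: complex poly \<Rightarrow> complex.
      (\<forall>p q. \<phi> (p + q) = \<phi> p + \<phi> q) \<and> (\<forall>c p. \<phi> (smult c p) = c * \<phi> p) \<and> \<phi> 1 = 1}"
  morphisms functional Abs_distribution
  by (rule exI[of _ "\<lambda>p. coeff p 0"]) simp

definition moment :: "distribution \<Rightarrow> nat \<Rightarrow> complex" where
  "moment \<mu> n = functional \<mu> (monom 1 n)"

lemma functional_add: "functional \<mu> (p + q) = functional \<mu> p + functional \<mu> q"
  and functional_smult: "functional \<mu> (smult c p) = c * functional \<mu> p"
  and functional_1: "functional \<mu> 1 = 1"
  using functional[of \<mu>] by auto

lemma moment_0 [simp]: "moment \<mu> 0 = 1"
  by (simp add: moment_def functional_1)

lemma functional_eq_moments: "functional \<mu> p = (\<Sum>i\<le>degree p. coeff p i * moment \<mu> i)"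
proof -
  have z: "functional \<mu> 0 = 0" using functional_smult[of \<mu> 0 0] by simp
  have s: "functional \<mu> (sum h A) = (\<Sum>i\<in>A. functional \<mu> (h i))" for h and A :: "nat set"
    by (induction A rule: infinite_finite_induct) (auto simp: z functional_add)
  have m: "functional \<mu> (monom c i) = c * moment \<mu> i" for c i
    using functional_smult[of \<mu> c "monom 1 i"] by (simp add: moment_def smult_monom)
  show ?thesis by (subst poly_as_sum_of_monoms[of p, symmetric]) (simp add: s m)
qed

lemma distribution_eqI:
  assumes "\<And>n. moment \<mu> n = moment \<nu> n"
  shows "\<mu> = \<nu>"
  by (subst functional_inject[symmetric]) (auto simp: functional_eq_moments assms fun_eq_iff)

definition distribution_of_moments :: "(nat \<Rightarrow> complex) \<Rightarrow> distribution" where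
  "distribution_of_moments M = (THE \<mu>. \<forall>n. moment \<mu> n = M n)"

lemma moment_distribution_of_moments:
  assumes M0: "M 0 = 1"
  shows "moment (distribution_of_moments M) n = M n"
proof -
  define \<phi> where "\<phi> p = (\<Sum>i\<le>degree p. coeff p i * M i)" for p :: "complex poly"
  have ext: "\<phi> p = (\<Sum>i\<le>m. coeff p i * M i)" if "degree p \<le> m" for p m
    unfolding \<phi>_def by (rule sum.mono_neutral_left) (use that in \<open>auto simp: coeff_eq_0\<close>)
  have add: "\<phi> (p + q) = \<phi> p + \<phi> q" for p q
  proof -
    let ?m = "max (degree p) (degree q)"
    have "\<phi> (p + q) = (\<Sum>i\<le>?m. coeff (p + q) i * M i)"
      by (rule ext) (rule degree_add_le_max)
    also have "\<dots> = \<phi> p + \<phi> q"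
      by (simp add: ext[of p ?m] ext[of q ?m] sum.distrib algebra_simps)
    finally show ?thesis .
  qed
  have scale: "\<phi> (smult c p) = c * \<phi> p" for c p
    using ext[of "smult c p" "degree p"]
    by (simp add: \<phi>_def[of p] degree_smult_le sum_distrib_left mult.assoc)
  have mon: "\<phi> (monom 1 n) = M n" for n
    by (simp add: \<phi>_def degree_monom_eq if_distrib[of "\<lambda>x. x * _"] cong: if_cong)
  have one: "\<phi> 1 = 1" using mon[of 0] M0 by simp
  have "functional (Abs_distribution \<phi>) = \<phi>"
    by (rule Abs_distribution_inverse) (auto simp: add scale one)
  then have "\<forall>n. moment (Abs_distribution \<phi>) n = M n" by (simp add: moment_def mon)
  then have "\<exists>!\<mu>. \<forall>n. moment \<mu> n = M n"
    by (intro ex1I[of _ "Abs_distribution \<phi>"]) (auto intro: distribution_eqI)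
  from theI'[OF this] show ?thesis unfolding distribution_of_moments_def by blast
qed

definition spectral_moment :: "('v, 'k) mgraph \<Rightarrow> 'v \<Rightarrow> nat \<Rightarrow> complex" where
  "spectral_moment G e n = ell2_inner (verts G) ((adj_op G ^^ n) (delta e)) (delta e)"

definition spectral_distribution :: "('v, 'k) mgraph \<Rightarrow> 'v \<Rightarrow> distribution" where
  "spectral_distribution G e = distribution_of_moments (spectral_moment G e)"

lemma moment_spectral_distribution:
  assumes "e \<in> verts G"
  shows "moment (spectral_distribution G e) n = spectral_moment G e n"
  unfolding spectral_distribution_def
proof (rule moment_distribution_of_moments)
  have "(\<Sum>\<^sub>\<infinity>x\<in>verts G. delta e x * cnj (delta e x)) = (\<Sum>\<^sub>\<infinity>x\<in>{e}. delta e x * cnj (delta e x))"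
    by (rule infsum_cong_neutral) (use assms in \<open>auto simp: delta_def\<close>)
  then show "spectral_moment G e 0 = 1"
    by (simp add: spectral_moment_def ell2_inner_def delta_def)
qed

definition birooted_spectral_distribution :: "('v, 'k) birooted \<Rightarrow> distribution \<times> distribution" where
  "birooted_spectral_distribution =
     (\<lambda>(G, e, f). (spectral_distribution G e, spectral_distribution G f))"

section \<open>Transforms and convolutions\<close>

text \<open>The transforms are formal series in descending powers of \<open>z\<close>, i.e. formal Laurent series in
  the indeterminate \<open>1/z\<close>. Thus \<open>cauchy_transform \<mu>\<close> is the power series
  \<open>M\<^sub>0 (1/z) + M\<^sub>1 (1/z)^2 + \<dots>\<close>, and \<open>z\<close> itself is \<open>fls_X_inv\<close>.\<close>

definition cauchy_transform :: "distribution \<Rightarrow> complex fps" where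
  "cauchy_transform \<mu> = Abs_fps (\<lambda>n. if n = 0 then 0 else moment \<mu> (n - 1))"

definition F_transform :: "distribution \<Rightarrow> complex fls" where
  "F_transform \<mu> = inverse (fps_to_fls (cauchy_transform \<mu>))"

text \<open>Replacing \<open>z\<close> by \<open>F_transform \<nu>\<close> means replacing the indeterminate \<open>1/z\<close> by
  \<open>1 / F_transform \<nu> = cauchy_transform \<nu>\<close>.\<close>

definition F_compose :: "distribution \<Rightarrow> distribution \<Rightarrow> complex fls" where
  "F_compose \<mu> \<nu> = fls_compose_fps (F_transform \<mu>) (cauchy_transform \<nu>)"

definition monotone_conv :: "distribution \<Rightarrow> distribution \<Rightarrow> distribution" where
  "monotone_conv \<nu>1 \<nu>2 = (THE \<nu>. F_transform \<nu> = F_compose \<nu>1 \<nu>2)"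

definition cmonotone_conv :: "distribution \<Rightarrow> distribution \<Rightarrow> distribution \<Rightarrow> distribution" where
  "cmonotone_conv \<mu>1 \<nu>2 \<mu>2 =
     (THE \<mu>. F_transform \<mu> = F_compose \<mu>1 \<nu>2 + F_transform \<mu>2 - F_transform \<nu>2)"

text \<open>The formal series that are F-transforms are those of the form \<open>z + c\<^sub>0 + c\<^sub>1 / z + \<dots>\<close>; both
  convolutions are therefore well defined.\<close>

lemma F_transform_inject: "F_transform \<mu> = F_transform \<nu> \<Longrightarrow> \<mu> = \<nu>"
proof (rule distribution_eqI)
  fix n assume "F_transform \<mu> = F_transform \<nu>"
  then have "cauchy_transform \<mu> = cauchy_transform \<nu>"
    by (simp add: F_transform_def)
  then have "cauchy_transform \<mu> $ Suc n = cauchy_transform \<nu> $ Suc n" by simp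
  then show "moment \<mu> n = moment \<nu> n" by (simp add: cauchy_transform_def)
qed

lemma ex_cauchy_transform:
  assumes "g $ 0 = 0" "g $ 1 = 1"
  shows "\<exists>\<mu>. cauchy_transform \<mu> = g"
proof
  show "cauchy_transform (distribution_of_moments (\<lambda>n. g $ Suc n)) = g"
    by (rule fps_ext) (use assms in \<open>auto simp: cauchy_transform_def moment_distribution_of_moments\<close>)
qed

lemma fls_X_inv_times_X: "fls_X_inv * fls_X = (1 :: complex fls)"
  by (metis fls_inverse_X fls_X_nonzero left_inverse)

lemma F_transform_form: "\<exists>h. F_transform \<mu> = fls_X_inv + fps_to_fls h"
proof -
  define g where "g = Abs_fps (moment \<mu>)"
  have g0: "g $ 0 = 1" by (simp add: g_def)
  have c: "cauchy_transform \<mu> = fps_X * g"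
    by (rule fps_ext) (auto simp: cauchy_transform_def g_def)
  have "inverse g = 1 + fps_X * fps_shift 1 (inverse g)"
    by (rule fps_ext) (auto simp: g0)
  then have "fps_to_fls (inverse g) = 1 + fls_X * fps_to_fls (fps_shift 1 (inverse g))"
    by (metis fls_times_fps_to_fls fps_X_to_fls fps_one_to_fls fps_to_fls_plus)
  moreover have "F_transform \<mu> = fls_X_inv * fps_to_fls (inverse g)"
    by (simp add: F_transform_def c fls_times_fps_to_fls fls_inverse_X fls_inverse_fps_to_fls
          subdegree_eq_0_iff g0)
  ultimately have "F_transform \<mu> = fls_X_inv + fls_X_inv * fls_X * fps_to_fls (fps_shift 1 (inverse g))"
    by (simp add: algebra_simps)
  then show ?thesis by (auto simp: fls_X_inv_times_X)
qed

lemma ex_F_transform: "\<exists>\<mu>. F_transform \<mu> = fls_X_inv + fps_to_fls h"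
proof -
  define u where "u = 1 + fps_X * h"
  have u0: "u $ 0 = 1" by (simp add: u_def)
  obtain \<mu> where \<mu>: "cauchy_transform \<mu> = fps_X * inverse u"
    using ex_cauchy_transform[of "fps_X * inverse u"] u0 by auto
  have "inverse (fps_to_fls (inverse u)) = fps_to_fls u"
    by (subst fls_inverse_fps_to_fls) (auto simp: subdegree_eq_0_iff u0)
  then have "F_transform \<mu> = fls_X_inv * fps_to_fls u"
    by (simp add: F_transform_def \<mu> fls_times_fps_to_fls fls_inverse_X)
  also have "\<dots> = fls_X_inv + fls_X_inv * fls_X * fps_to_fls h"
    by (simp add: u_def fls_times_fps_to_fls algebra_simps)
  finally show ?thesis by (auto simp: fls_X_inv_times_X)
qed

lemma F_compose_form: "\<exists>h. F_compose \<mu> \<nu> = fls_X_inv + fps_to_fls h"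
proof -
  let ?m = "cauchy_transform \<mu>" and ?n = "cauchy_transform \<nu>"
  have n0: "?n $ 0 = 0" and n1: "?n $ 1 = 1" and m0: "?m $ 0 = 0" and m1: "?m $ 1 = 1"
    by (simp_all add: cauchy_transform_def)
  have ne: "?n \<noteq> 0" using n1 by auto
  have "F_compose \<mu> \<nu> = inverse (fps_to_fls (fps_compose ?m ?n))"
    using n0 ne by (simp add: F_compose_def F_transform_def fls_compose_fps_inverse)
  moreover obtain \<rho> where "cauchy_transform \<rho> = fps_compose ?m ?n"
    using ex_cauchy_transform[of "fps_compose ?m ?n"] n0 n1 m0 m1
    by (auto simp: fps_compose_nth)
  ultimately have "F_compose \<mu> \<nu> = F_transform \<rho>" by (simp add: F_transform_def)
  then show ?thesis using F_transform_form by metis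
qed

lemma F_transform_monotone_conv:
  "F_transform (monotone_conv \<nu>1 \<nu>2) = F_compose \<nu>1 \<nu>2"
proof -
  have "\<exists>!\<nu>. F_transform \<nu> = F_compose \<nu>1 \<nu>2"
    using F_compose_form ex_F_transform F_transform_inject by metis
  from theI'[OF this] show ?thesis by (simp add: monotone_conv_def)
qed

lemma F_transform_cmonotone_conv:
  "F_transform (cmonotone_conv \<mu>1 \<nu>2 \<mu>2) = F_compose \<mu>1 \<nu>2 + F_transform \<mu>2 - F_transform \<nu>2"
proof -
  obtain h1 h2 h3 where "F_compose \<mu>1 \<nu>2 = fls_X_inv + fps_to_fls h1"
      "F_transform \<mu>2 = fls_X_inv + fps_to_fls h2" "F_transform \<nu>2 = fls_X_inv + fps_to_fls h3"
    using F_compose_form F_transform_form by metis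
  then have "F_compose \<mu>1 \<nu>2 + F_transform \<mu>2 - F_transform \<nu>2 = fls_X_inv + fps_to_fls (h1 + h2 - h3)"
    by simp
  then have "\<exists>!\<mu>. F_transform \<mu> = F_compose \<mu>1 \<nu>2 + F_transform \<mu>2 - F_transform \<nu>2"
    using ex_F_transform F_transform_inject by metis
  from theI'[OF this] show ?thesis by (simp add: cmonotone_conv_def)
qed

section \<open>Products of graphs\<close>

text \<open>\<open>attach G1 G2 g\<close> glues, for each vertex \<open>x\<close> of \<open>G1\<close>, a copy of \<open>G2\<close> by its vertex \<open>g x\<close>
  to \<open>x\<close>. The vertex \<open>y\<close> of the copy at \<open>x\<close> is \<open>(x, y)\<close>, and the vertex \<open>x\<close> of \<open>G1\<close> is identified
  with \<open>(x, g x)\<close>.\<close>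

definition attach ::
  "('v, 'k) mgraph \<Rightarrow> ('w, 'l) mgraph \<Rightarrow> ('v \<Rightarrow> 'w) \<Rightarrow> ('v \<times> 'w, 'k + 'v \<times> 'l) mgraph" where
  "attach G1 G2 g =
     \<lparr> verts = verts G1 \<times> verts G2,
       edges = edges G1 <+> (verts G1 \<times> edges G2),
       ends = (\<lambda>k. case k of
                 Inl k1 \<Rightarrow> (\<lambda>x. (x, g x)) ` ends G1 k1
               | Inr (x, k2) \<Rightarrow> (\<lambda>y. (x, y)) ` ends G2 k2) \<rparr>"

text \<open>The second components of the following two pairs are the roots.\<close>

definition comb_product ::
  "('v, 'k) mgraph \<times> 'v \<Rightarrow> ('w, 'l) mgraph \<times> 'w \<Rightarrow> ('v \<times> 'w, 'k + 'v \<times> 'l) mgraph \<times> ('v \<times> 'w)" where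
  "comb_product = (\<lambda>(G1, f1) (G2, f2). (attach G1 G2 (\<lambda>x. f2), (f1, f2)))"

definition comb_product_at ::
  "('v, 'k) mgraph \<times> 'v \<Rightarrow> 'w \<Rightarrow> ('w, 'l) mgraph \<times> 'w
     \<Rightarrow> ('v \<times> 'w, 'k + 'v \<times> 'l) mgraph \<times> ('v \<times> 'w)" where
  "comb_product_at =
     (\<lambda>(G1, e1) f2 (G2, e2). (attach G1 G2 (\<lambda>x. if x = e1 then e2 else f2), (e1, e2)))"

definition disjoint_union ::
  "('v, 'k) mgraph \<Rightarrow> ('w, 'l) mgraph \<Rightarrow> ('v + 'w, 'k + 'l) mgraph" where
  "disjoint_union G H =
     \<lparr> verts = verts G <+> verts H,
       edges = edges G <+> edges H,
       ends = (\<lambda>k. case k of Inl a \<Rightarrow> Inl ` ends G a | Inr b \<Rightarrow> Inr ` ends H b) \<rparr>"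

definition c_comb_product ::
  "('v, 'k) birooted \<Rightarrow> ('w, 'l) birooted
     \<Rightarrow> ('v \<times> 'w + 'v \<times> 'w, ('k + 'v \<times> 'l) + ('k + 'v \<times> 'l)) birooted" where
  "c_comb_product = (\<lambda>(G1, e1, f1) (G2, e2, f2).
     let (G, e) = comb_product_at (G1, e1) f2 (G2, e2);
         (H, f) = comb_product (G1, f1) (G2, f2)
     in (disjoint_union G H, Inl e, Inr f))"

end

theory Submission
  imports Defs
begin

text \<open>
  Put \<open>t = 1/z\<close>. The Cauchy transform of the spectral distribution at \<open>e\<close> is \<open>t\<close> times the generating
  function of the closed walks at \<open>e\<close>, so the theorem is an identity between formal power series
  that count walks. It is proved by solving linear equations, without counting or decomposing
  walks. For a fixed start \<open>e\<close>, the generating functions \<open>R x\<close> of the walks from \<open>e\<close> to \<open>x\<close> satisfy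
  the resolvent equation \<open>R = \<delta>\<^sub>e + t A R\<close>, which determines \<open>R\<close> because the coefficients at
  \<open>t\<^sup>n\<^sup>+\<^sup>1\<close> are given by those at \<open>t\<^sup>n\<close> (\<open>solves_resolvent_unique\<close>). Hence any vector of power
  series that satisfies the equation is the right one.

  Glue to every vertex \<open>x\<close> of \<open>G1\<close> a copy of \<open>G2\<close> by \<open>g x\<close>. Inside the copy at \<open>x\<close> the equation is
  that of \<open>G2\<close> with source at \<open>g x\<close>, since the copy meets the rest of the graph only there. So the
  solution has the form \<open>S x * W y\<close>, where \<open>W\<close> is the resolvent vector of \<open>(G2, g x)\<close>, and what
  remains is an equation for \<open>S\<close> on \<open>G1\<close> alone,
  \<open>S x = \<delta>\<^sub>r x + t \<Sum>\<^sub>x\<^sub>' a(x, x') S x' m x'\<close>, where \<open>r\<close> is the vertex of \<open>G1\<close> from which the walks start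
  and \<open>m x\<close> is the closed walk series of \<open>G2\<close> at \<open>g x\<close> (\<open>walk_series_attach\<close>).

  For the comb product all \<open>m x\<close> equal one series \<open>m\<close>, and the equation for \<open>S\<close> is the resolvent
  equation of \<open>G1\<close> with \<open>t m\<close> in place of \<open>t\<close>. This substitution is the composition of Cauchy
  transforms, hence of F-transforms (\<open>walk_series_comb_root\<close>).

  For the other summand, \<open>m x\<close> differs from \<open>m\<^sub>f\<close>, the series of \<open>(G2, f2)\<close>, only at the root, where
  it is the series \<open>m\<^sub>e\<close> of \<open>(G2, e2)\<close>. The equation for \<open>S m\<close> is then the one of the comb product of
  \<open>(G1, e1)\<close> and \<open>(G2, f2)\<close> with a multiple of the source. If \<open>T\<close> is the closed walk series at the
  root and \<open>K\<close> that of this comb product, the multiple is \<open>1 + T (1/m\<^sub>f - 1/m\<^sub>e)\<close> and \<open>T\<close> is \<open>K\<close> times it,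
  that is, \<open>1/T = 1/K + 1/m\<^sub>e - 1/m\<^sub>f\<close> (\<open>walk_series_comb_at_root\<close>). Dividing by \<open>t\<close> gives the
  F-transform of the c-monotone convolution.
\<close>

section \<open>Sums over neighbours\<close>

definition locally_finite :: "('v, 'k) mgraph \<Rightarrow> bool" where
  "locally_finite G \<longleftrightarrow> (\<forall>x\<in>verts G. finite {k\<in>edges G. x \<in> ends G k})"

definition neighbours :: "('v, 'k) mgraph \<Rightarrow> 'v \<Rightarrow> 'v set" where
  "neighbours G x = {y\<in>verts G. adj G x y \<noteq> 0}"

lemma locally_finite_if_uniformly: "uniformly_locally_finite G \<Longrightarrow> locally_finite G"
  by (auto simp: uniformly_locally_finite_def locally_finite_def)

lemma neighbours_subset: "neighbours G x \<subseteq> verts G"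
  by (auto simp: neighbours_def)

lemma finite_edges_between:
  assumes "locally_finite G" "x \<in> verts G"
  shows "finite {k\<in>edges G. ends G k = {x, y}}"
  by (rule finite_subset[of _ "{k\<in>edges G. x \<in> ends G k}"])
     (use assms in \<open>auto simp: locally_finite_def\<close>)

lemma finite_neighbours:
  assumes "locally_finite G" "x \<in> verts G"
  shows "finite (neighbours G x)"
proof (rule finite_subset)
  show "neighbours G x \<subseteq> (\<Union>k\<in>{k\<in>edges G. x \<in> ends G k}. {y. ends G k = {x, y}})"
  proof
    fix y assume "y \<in> neighbours G x"
    then have "{k\<in>edges G. ends G k = {x, y}} \<noteq> {}"
      by (metis (mono_tags, lifting) neighbours_def adj_def card.empty mem_Collect_eq)
    then show "y \<in> (\<Union>k\<in>{k\<in>edges G. x \<in> ends G k}. {y. ends G k = {x, y}})" by auto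
  qed
  have "finite {y. B = {x, y}}" for B
  proof (cases "\<exists>y. B = {x, y}")
    case True
    then obtain y where "B = {x, y}" by blast
    then have "{z. B = {x, z}} \<subseteq> {y}" by (auto simp: doubleton_eq_iff)
    then show ?thesis using finite_subset by blast
  qed simp
  then show "finite (\<Union>k\<in>{k\<in>edges G. x \<in> ends G k}. {y. ends G k = {x, y}})"
    using assms by (auto simp: locally_finite_def)
qed

text \<open>The neighbours of a vertex in a product graph are awkward to enumerate, but they lie in a finite
  product set; this lemma allows summing over that set instead.\<close>

lemma sum_neighbours_mono_neutral:
  fixes h :: "'v \<Rightarrow> 'a::semiring_1"
  assumes "finite S" "neighbours G x \<subseteq> S" "S \<subseteq> verts G"
  shows "(\<Sum>y\<in>neighbours G x. of_nat (adj G x y) * h y) = (\<Sum>y\<in>S. of_nat (adj G x y) * h y)"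
proof (rule sum.mono_neutral_left[OF assms(1,2)])
  show "\<forall>y\<in>S - neighbours G x. of_nat (adj G x y) * h y = 0"
  proof
    fix y assume "y \<in> S - neighbours G x"
    then have "adj G x y = 0" using assms(3) by (auto simp: neighbours_def)
    then show "of_nat (adj G x y) * h y = 0" by simp
  qed
qed

text \<open>Local finiteness turns the infinite sums of the adjacency operator into finite ones, so the
  coefficients of power series can be compared one by one.\<close>

lemma adj_op_eq_sum_neighbours:
  assumes "locally_finite G" "x \<in> verts G"
  shows "adj_op G \<psi> x = (\<Sum>y\<in>neighbours G x. of_nat (adj G x y) * \<psi> y)"
proof -
  have "(\<Sum>\<^sub>\<infinity>y\<in>verts G. of_nat (adj G x y) * \<psi> y)
      = (\<Sum>\<^sub>\<infinity>y\<in>neighbours G x. of_nat (adj G x y) * \<psi> y)"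
    by (rule infsum_cong_neutral) (auto simp: neighbours_def)
  then show ?thesis using assms finite_neighbours[OF assms] by (simp add: adj_op_def)
qed

section \<open>Walk series and the resolvent equation\<close>

text \<open>Its coefficient at \<open>n\<close> is the number of walks of length \<open>n\<close> from \<open>e\<close> to \<open>x\<close>. As a function of \<open>x\<close>
  it is the vector \<open>(1 - t a(G))\<^sup>-\<^sup>1 \<delta>(e)\<close>.\<close>

definition walk_series :: "('v, 'k) mgraph \<Rightarrow> 'v \<Rightarrow> 'v \<Rightarrow> complex fps" where
  "walk_series G e x = Abs_fps (\<lambda>n. (adj_op G ^^ n) (delta e) x)"

text \<open>The equation \<open>R = \<delta>(e) + t a(G) R\<close>, asked for at the vertices of \<open>G\<close> only.\<close>

definition solves_resolvent :: "('v, 'k) mgraph \<Rightarrow> 'v \<Rightarrow> ('v \<Rightarrow> complex fps) \<Rightarrow> bool" where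
  "solves_resolvent G e R \<longleftrightarrow>
     (\<forall>x\<in>verts G. R x = (if x = e then 1 else 0)
                         + fps_X * (\<Sum>y\<in>neighbours G x. of_nat (adj G x y) * R y))"

lemma walk_series_solves_resolvent:
  assumes "locally_finite G"
  shows "solves_resolvent G e (walk_series G e)"
  unfolding solves_resolvent_def
proof (intro ballI fps_ext)
  fix x n assume x: "x \<in> verts G"
  show "walk_series G e x $ n = ((if x = e then 1 else 0)
      + fps_X * (\<Sum>y\<in>neighbours G x. of_nat (adj G x y) * walk_series G e y)) $ n"
  proof (cases n)
    case 0
    then show ?thesis by (simp add: walk_series_def delta_def)
  next
    case (Suc m)
    then show ?thesis
      by (simp add: walk_series_def adj_op_eq_sum_neighbours[OF assms x] fps_sum_nth
          flip: fps_of_nat)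
  qed
qed

text \<open>The factor \<open>fps_X\<close> makes the equation a recursion: the coefficients at \<open>0\<close> are prescribed, and
  those at \<open>n + 1\<close> are obtained by applying the adjacency matrix to those at \<open>n\<close>.\<close>

lemma solves_resolvent_unique:
  assumes G: "locally_finite G" and R: "solves_resolvent G e R" and x: "x \<in> verts G"
  shows "R x = walk_series G e x"
proof (rule fps_ext)
  have R': "R z = (if z = e then 1 else 0)
      + fps_X * (\<Sum>y\<in>neighbours G z. of_nat (adj G z y) * R y)" if "z \<in> verts G" for z
    using R that unfolding solves_resolvent_def by blast
  fix n
  show "R x $ n = walk_series G e x $ n"
    using x
  proof (induction n arbitrary: x)
    case 0
    then show ?case by (subst R') (auto simp: walk_series_def delta_def)
  next
    case (Suc n)
    have "R x $ Suc n = (\<Sum>y\<in>neighbours G x. of_nat (adj G x y) * R y $ n)"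
      by (subst R'[OF Suc.prems]) (simp add: fps_sum_nth flip: fps_of_nat)
    also have "\<dots> = (\<Sum>y\<in>neighbours G x. of_nat (adj G x y) * walk_series G e y $ n)"
      using Suc.IH neighbours_subset[of G x] by (intro sum.cong refl) (auto dest: subsetD)
    also have "\<dots> = walk_series G e x $ Suc n"
      by (simp add: walk_series_def adj_op_eq_sum_neighbours[OF G Suc.prems])
    finally show ?case .
  qed
qed

lemma spectral_moment_eq_walk_series_nth:
  assumes "e \<in> verts G"
  shows "spectral_moment G e n = walk_series G e e $ n"
proof -
  have "(\<Sum>\<^sub>\<infinity>x\<in>verts G. \<psi> x * cnj (delta e x)) = (\<Sum>\<^sub>\<infinity>x\<in>{e}. \<psi> x * cnj (delta e x))" for \<psi>
    by (rule infsum_cong_neutral) (use assms in \<open>auto simp: delta_def\<close>)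
  then show ?thesis
    by (simp add: spectral_moment_def ell2_inner_def walk_series_def delta_def)
qed

lemma cauchy_transform_spectral:
  assumes "e \<in> verts G"
  shows "cauchy_transform (spectral_distribution G e) = fps_X * walk_series G e e"
  by (rule fps_ext)
     (auto simp: cauchy_transform_def moment_spectral_distribution spectral_moment_eq_walk_series_nth assms)

lemma walk_series_root_nth_0: "walk_series G e e $ 0 = 1"
  by (simp add: walk_series_def delta_def)

section \<open>Walks in a graph with attached copies of another graph\<close>

lemma verts_attach: "verts (attach G1 G2 g) = verts G1 \<times> verts G2"
  by (simp add: attach_def)

lemma locally_finite_attach:
  assumes "locally_finite G1" "locally_finite G2"
  shows "locally_finite (attach G1 G2 g)"
  unfolding locally_finite_def
proof
  fix p assume "p \<in> verts (attach G1 G2 g)"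
  then obtain x y where p: "p = (x, y)" "x \<in> verts G1" "y \<in> verts G2"
    by (auto simp: attach_def)
  have "{k\<in>edges (attach G1 G2 g). p \<in> ends (attach G1 G2 g) k}
      \<subseteq> {k\<in>edges G1. x \<in> ends G1 k} <+> {x} \<times> {k\<in>edges G2. y \<in> ends G2 k}"
    by (auto simp: attach_def p(1))
  then show "finite {k\<in>edges (attach G1 G2 g). p \<in> ends (attach G1 G2 g) k}"
    by (rule finite_subset) (use assms p in \<open>auto simp: locally_finite_def\<close>)
qed

text \<open>Edges of the copies of \<open>G2\<close> and edges of \<open>G1\<close> both contribute. Both contributions can be nonzero
  at once, for instance when loops of \<open>G1\<close> and of \<open>G2\<close> meet at a glued vertex. Finiteness matters:
  the numbers of edges are cardinalities, and those add up only for finite sets.\<close>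

lemma adj_attach:
  assumes "locally_finite G1" "locally_finite G2" and x: "x \<in> verts G1" and y: "y \<in> verts G2"
  shows "adj (attach G1 G2 g) (x, y) (x', y')
       = (if x' = x then adj G2 y y' else 0) + (if y = g x \<and> y' = g x' then adj G1 x x' else 0)"
proof -
  let ?A = "if y = g x \<and> y' = g x' then {k\<in>edges G1. ends G1 k = {x, x'}} else {}"
  let ?B = "if x' = x then {k\<in>edges G2. ends G2 k = {y, y'}} else {}"
  \<comment> \<open>The end points of an edge can be recovered from their images by a projection.\<close>
  have A: "(\<lambda>z. (z, g z)) ` E = {(x, y), (x', y')} \<longleftrightarrow> y = g x \<and> y' = g x' \<and> E = {x, x'}" for E
  proof
    assume *: "(\<lambda>z. (z, g z)) ` E = {(x, y), (x', y')}"
    then have "fst ` (\<lambda>z. (z, g z)) ` E = {x, x'}" by simp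
    then have "E = {x, x'}" by (simp add: image_image)
    moreover have "(x, y) \<in> (\<lambda>z. (z, g z)) ` E" "(x', y') \<in> (\<lambda>z. (z, g z)) ` E"
      unfolding * by auto
    ultimately show "y = g x \<and> y' = g x' \<and> E = {x, x'}" by auto
  qed auto
  have B: "Pair z ` E = {(x, y), (x', y')} \<longleftrightarrow> z = x \<and> x' = x \<and> E = {y, y'}" for z E
  proof
    assume *: "Pair z ` E = {(x, y), (x', y')}"
    then have "snd ` Pair z ` E = {y, y'}" by simp
    then have "E = {y, y'}" by (simp add: image_image)
    moreover have "(x, y) \<in> Pair z ` E" "(x', y') \<in> Pair z ` E"
      unfolding * by auto
    ultimately show "z = x \<and> x' = x \<and> E = {y, y'}" by auto
  qed auto
  have eq: "{k\<in>edges (attach G1 G2 g). ends (attach G1 G2 g) k = {(x, y), (x', y')}}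
      = ?A <+> {x} \<times> ?B"
  proof (rule set_eqI)
    fix k
    show "k \<in> {k\<in>edges (attach G1 G2 g). ends (attach G1 G2 g) k = {(x, y), (x', y')}}
        \<longleftrightarrow> k \<in> ?A <+> {x} \<times> ?B"
    proof (cases k)
      case (Inl k1)
      then show ?thesis by (simp add: attach_def A Plus_def image_iff) blast
    next
      case (Inr zk)
      obtain z k2 where "zk = (z, k2)" by (cases zk)
      with Inr x show ?thesis by (simp add: attach_def B Plus_def image_iff) blast
    qed
  qed
  have "finite ?A" "finite ?B"
    by (simp_all add: finite_edges_between assms)
  then have "adj (attach G1 G2 g) (x, y) (x', y') = card ?A + card ?B"
    unfolding adj_def eq by (subst card_Plus) (simp_all add: card_cartesian_product)
  then show ?thesis by (simp add: adj_def)
qed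

lemma sum_neighbours_attach:
  fixes h :: "'v \<times> 'w \<Rightarrow> 'a::comm_semiring_1"
  assumes G: "locally_finite G1" "locally_finite G2" and x: "x \<in> verts G1" and y: "y \<in> verts G2"
    and g: "g ` verts G1 \<subseteq> verts G2"
  shows "(\<Sum>p\<in>neighbours (attach G1 G2 g) (x, y). of_nat (adj (attach G1 G2 g) (x, y) p) * h p)
       = (\<Sum>y'\<in>neighbours G2 y. of_nat (adj G2 y y') * h (x, y'))
         + (if y = g x then \<Sum>x'\<in>neighbours G1 x. of_nat (adj G1 x x') * h (x', g x') else 0)"
    (is "?L = ?R")
proof -
  \<comment> \<open>The vertex \<open>x\<close> is included because the neighbours inside the copy at \<open>x\<close> have it as first
    component, although it need not be a neighbour of itself in \<open>G1\<close>.\<close>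
  let ?N1 = "insert x (neighbours G1 x)"
  let ?N2 = "neighbours G2 y \<union> g ` ?N1"
  have fin: "finite ?N1" "finite ?N2"
    using finite_neighbours[OF G(1) x] finite_neighbours[OF G(2) y] by auto
  have sub: "?N1 \<subseteq> verts G1" "?N2 \<subseteq> verts G2"
    using neighbours_subset[of G1] neighbours_subset[of G2] x g by blast+
  have nb: "neighbours (attach G1 G2 g) (x, y) \<subseteq> ?N1 \<times> ?N2"
    by (auto simp: neighbours_def adj_attach[OF G x y] verts_attach split: if_splits)
  have "?L = (\<Sum>p\<in>?N1 \<times> ?N2. of_nat (adj (attach G1 G2 g) (x, y) p) * h p)"
    by (rule sum_neighbours_mono_neutral) (use fin sub nb in \<open>auto simp: verts_attach\<close>)
  also have "\<dots> = (\<Sum>x'\<in>?N1. \<Sum>y'\<in>?N2. of_nat (adj (attach G1 G2 g) (x, y) (x', y')) * h (x', y'))"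
    by (simp add: sum.cartesian_product case_prod_unfold)
  also have "\<dots> = (\<Sum>x'\<in>?N1. (if x' = x then \<Sum>y'\<in>?N2. of_nat (adj G2 y y') * h (x, y') else 0)
      + (if y = g x then of_nat (adj G1 x x') * h (x', g x') else 0))"
  proof (rule sum.cong[OF refl])
    fix x' assume x': "x' \<in> ?N1"
    have "(\<Sum>y'\<in>?N2. of_nat (adj (attach G1 G2 g) (x, y) (x', y')) * h (x', y'))
       = (\<Sum>y'\<in>?N2. (if x' = x then of_nat (adj G2 y y') * h (x, y') else 0)
            + (if y' = g x' then (if y = g x then of_nat (adj G1 x x') * h (x', g x') else 0) else 0))"
      by (intro sum.cong refl) (auto simp: adj_attach[OF G x y] distrib_right)
    also have "\<dots> = (\<Sum>y'\<in>?N2. if x' = x then of_nat (adj G2 y y') * h (x, y') else 0)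
         + (if y = g x then of_nat (adj G1 x x') * h (x', g x') else 0)"
      using x' fin(2) by (simp only: sum.distrib sum.delta) auto
    finally show "(\<Sum>y'\<in>?N2. of_nat (adj (attach G1 G2 g) (x, y) (x', y')) * h (x', y'))
       = (if x' = x then \<Sum>y'\<in>?N2. of_nat (adj G2 y y') * h (x, y') else 0)
         + (if y = g x then of_nat (adj G1 x x') * h (x', g x') else 0)"
      by auto
  qed
  also have "\<dots> = (\<Sum>y'\<in>?N2. of_nat (adj G2 y y') * h (x, y'))
      + (if y = g x then \<Sum>x'\<in>?N1. of_nat (adj G1 x x') * h (x', g x') else 0)"
    using fin(1) by (simp only: sum.distrib sum.delta) auto
  also have "(\<Sum>y'\<in>?N2. of_nat (adj G2 y y') * h (x, y'))
      = (\<Sum>y'\<in>neighbours G2 y. of_nat (adj G2 y y') * h (x, y'))"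
    by (rule sum_neighbours_mono_neutral[symmetric]) (use fin sub in auto)
  also have "(\<Sum>x'\<in>?N1. of_nat (adj G1 x x') * h (x', g x'))
      = (\<Sum>x'\<in>neighbours G1 x. of_nat (adj G1 x x') * h (x', g x'))"
    by (rule sum_neighbours_mono_neutral[symmetric]) (use fin sub in auto)
  finally show ?thesis .
qed

text \<open>After its last edge of \<open>G1\<close>, a walk from the root to \<open>(x, y)\<close> stays inside the copy at \<open>x\<close> and goes
  there from \<open>g x\<close> to \<open>y\<close>. So \<open>S x\<close> counts the walks to \<open>(x, g x)\<close> that end with an edge of \<open>G1\<close>, and the
  empty walk if \<open>x = r\<close>. Removing this edge, which comes from some \<open>x'\<close>, leaves a walk to
  \<open>(x', g x')\<close>, counted by \<open>S x'\<close> times the closed walk series of the copy at \<open>x'\<close>; this is the equation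
  for \<open>S\<close>. Formally, the product is checked to solve the resolvent equation.\<close>

lemma walk_series_attach:
  assumes G: "locally_finite G1" "locally_finite G2"
    and g: "g ` verts G1 \<subseteq> verts G2"
    and S: "\<And>x. x \<in> verts G1 \<Longrightarrow> S x = (if x = r then 1 else 0)
        + fps_X * (\<Sum>x'\<in>neighbours G1 x. of_nat (adj G1 x x') * (S x' * walk_series G2 (g x') (g x')))"
    and xy: "x \<in> verts G1" "y \<in> verts G2"
  shows "walk_series (attach G1 G2 g) (r, g r) (x, y) = S x * walk_series G2 (g x) y"
proof -
  define R where "R = (\<lambda>(x, y). S x * walk_series G2 (g x) y)"
  have "solves_resolvent (attach G1 G2 g) (r, g r) R"
    unfolding solves_resolvent_def
  proof
    fix p assume "p \<in> verts (attach G1 G2 g)"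
    then obtain x y where p: "p = (x, y)" and x: "x \<in> verts G1" and y: "y \<in> verts G2"
      by (auto simp: verts_attach)
    let ?s2 = "\<Sum>y'\<in>neighbours G2 y. of_nat (adj G2 y y') * walk_series G2 (g x) y'"
    let ?s1 = "\<Sum>x'\<in>neighbours G1 x. of_nat (adj G1 x x') * (S x' * walk_series G2 (g x') (g x'))"
    have W: "walk_series G2 (g x) y = (if y = g x then 1 else 0) + fps_X * ?s2"
      using walk_series_solves_resolvent[OF G(2)] y unfolding solves_resolvent_def by blast
    have "(\<Sum>q\<in>neighbours (attach G1 G2 g) p. of_nat (adj (attach G1 G2 g) p q) * R q)
        = S x * ?s2 + (if y = g x then ?s1 else 0)"
      unfolding p sum_neighbours_attach[OF G x y g] R_def
      by (simp add: sum_distrib_left mult.left_commute)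
    moreover have "R p = (if p = (r, g r) then 1 else 0)
        + fps_X * (S x * ?s2 + (if y = g x then ?s1 else 0))"
    proof (cases "y = g x")
      case True
      have "walk_series G2 (g x) y = 1 + fps_X * ?s2"
        using W unfolding if_P[OF True] .
      then have "R p = S x + fps_X * (S x * ?s2)"
        by (simp only: R_def p prod.case distrib_left mult_1_right mult.left_commute)
      then have "R p = (if x = r then 1 else 0) + fps_X * ?s1 + fps_X * (S x * ?s2)"
        by (simp only: flip: S[OF x])
      then show ?thesis
        using True by (auto simp: p distrib_left)
    next
      case False
      have "walk_series G2 (g x) y = fps_X * ?s2"
        using W unfolding if_not_P[OF False] add_0 .
      then have "R p = fps_X * (S x * ?s2)"
        by (simp only: R_def p prod.case mult.left_commute)
      then show ?thesis
        using False by (auto simp: p)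
    qed
    ultimately show "R p = (if p = (r, g r) then 1 else 0)
        + fps_X * (\<Sum>q\<in>neighbours (attach G1 G2 g) p. of_nat (adj (attach G1 G2 g) p q) * R q)"
      by simp
  qed
  then have "R (x, y) = walk_series (attach G1 G2 g) (r, g r) (x, y)"
    by (rule solves_resolvent_unique[OF locally_finite_attach[OF G]]) (use xy in \<open>simp add: verts_attach\<close>)
  then show ?thesis by (simp add: R_def)
qed

section \<open>The two summands of the c-comb product\<close>

text \<open>The resolvent equation of \<open>G\<close> after replacing \<open>t\<close> by \<open>t m\<close>. The additional factor \<open>m\<close> per step is the
  closed walk that a walk in a comb product makes in an attached copy before each edge of \<open>G\<close>.\<close>

lemma walk_series_compose:
  assumes "locally_finite G" "x \<in> verts G"
  shows "walk_series G e x oo (fps_X * m) = (if x = e then 1 else 0)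
      + fps_X * (\<Sum>y\<in>neighbours G x. of_nat (adj G x y) * ((walk_series G e y oo (fps_X * m)) * m))"
proof -
  have "walk_series G e x = (if x = e then 1 else 0)
      + fps_X * (\<Sum>y\<in>neighbours G x. of_nat (adj G x y) * walk_series G e y)"
    using walk_series_solves_resolvent[OF assms(1)] assms(2) unfolding solves_resolvent_def by blast
  then have "walk_series G e x oo (fps_X * m) = ((if x = e then 1 else 0)
      + fps_X * (\<Sum>y\<in>neighbours G x. of_nat (adj G x y) * walk_series G e y)) oo (fps_X * m)"
    by (rule arg_cong)
  then show ?thesis
    by (simp add: fps_compose_add_distrib fps_compose_mult_distrib fps_compose_sum_distrib
        sum_distrib_left mult_ac flip: fps_of_nat)
qed

lemma walk_series_comb_root:
  assumes "locally_finite G1" "locally_finite G2" "f1 \<in> verts G1" "f2 \<in> verts G2"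
  shows "walk_series (attach G1 G2 (\<lambda>x. f2)) (f1, f2) (f1, f2)
       = (walk_series G1 f1 f1 oo (fps_X * walk_series G2 f2 f2)) * walk_series G2 f2 f2"
  by (rule walk_series_attach[OF assms(1,2),
        where S = "\<lambda>x. walk_series G1 f1 x oo (fps_X * walk_series G2 f2 f2)",
        OF _ walk_series_compose[OF assms(1)]])
     (use assms in auto)

text \<open>With \<open>T\<close> for the walk series on the left, the claim is \<open>1/T = 1/K + 1/me - 1/mf\<close>, stated without
  division. Here \<open>K\<close> is the closed walk series at the root of the comb product of \<open>(G1, e1)\<close> and
  \<open>(G2, f2)\<close>. The proof exhibits the solution \<open>S\<close> required by \<open>walk_series_attach\<close>.\<close>

lemma walk_series_comb_at_root:
  assumes G: "locally_finite G1" "locally_finite G2"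
    and V: "e1 \<in> verts G1" "e2 \<in> verts G2" "f2 \<in> verts G2"
  defines "me \<equiv> walk_series G2 e2 e2" and "mf \<equiv> walk_series G2 f2 f2"
  defines "K \<equiv> (walk_series G1 e1 e1 oo (fps_X * mf)) * mf"
  shows "walk_series (attach G1 G2 (\<lambda>x. if x = e1 then e2 else f2)) (e1, e2) (e1, e2)
           * (mf * me - K * me + K * mf) = K * mf * me"
proof -
  let ?g = "\<lambda>x. if x = e1 then e2 else f2"
  define P where "P x = walk_series G1 e1 x oo (fps_X * mf)" for x
  define D where "D = mf * me - K * me + K * mf"
  have K: "K = P e1 * mf" by (simp add: K_def P_def)
  have "D $ 0 = 1"
    by (simp add: D_def K_def me_def mf_def fps_mult_nth_0 walk_series_root_nth_0)
  then have D: "inverse D * D = 1" by (intro inverse_mult_eq_1) simp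
  \<comment> \<open>In \<open>walk_series_attach\<close> the series \<open>m x\<close> is \<open>mf\<close> except at \<open>e1\<close>. Outside \<open>e1\<close> the equation for \<open>S\<close>
    is that for \<open>P\<close>, so \<open>S\<close> is a multiple \<open>c P\<close> there; at \<open>e1\<close> it is chosen such that \<open>S x * m x\<close> is
    \<open>c P x mf\<close> throughout (\<open>Sm\<close>). The equation at \<open>e1\<close> then forces the value of \<open>c\<close>.\<close>
  define c where "c = mf * me * inverse D"
  define S where "S x = (if x = e1 then K * mf * inverse D else c * P x)" for x
  have Sm: "S x * walk_series G2 (?g x) (?g x) = c * (P x * mf)" for x
    by (simp add: S_def c_def K me_def mf_def mult_ac)
  have "S x = (if x = e1 then 1 else 0)
      + fps_X * (\<Sum>x'\<in>neighbours G1 x. of_nat (adj G1 x x') * (S x' * walk_series G2 (?g x') (?g x')))"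
    if x: "x \<in> verts G1" for x
  proof -
    let ?s = "fps_X * (\<Sum>x'\<in>neighbours G1 x. of_nat (adj G1 x x') * (P x' * mf))"
    have P: "P x = (if x = e1 then 1 else 0) + ?s"
      unfolding P_def by (rule walk_series_compose[OF G(1) x])
    have "fps_X * (\<Sum>x'\<in>neighbours G1 x. of_nat (adj G1 x x') * (S x' * walk_series G2 (?g x') (?g x')))
        = c * ?s"
      unfolding Sm by (simp add: sum_distrib_left mult_ac)
    also have "?s = P x - (if x = e1 then 1 else 0)" using P by simp
    finally have s: "fps_X * (\<Sum>x'\<in>neighbours G1 x. of_nat (adj G1 x x') * (S x' * walk_series G2 (?g x') (?g x')))
        = c * (P x - (if x = e1 then 1 else 0))" .
    have "K * mf * inverse D = 1 + c * (P e1 - 1)"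
    proof -
      have "1 + c * (P e1 - 1) = 1 + inverse D * (mf * me * (P e1 - 1))"
        by (simp add: c_def mult_ac)
      also have "\<dots> = inverse D * (D + mf * me * (P e1 - 1))"
        by (simp only: distrib_left D)
      also have "D + mf * me * (P e1 - 1) = K * mf" by (simp add: D_def K algebra_simps)
      finally show ?thesis by (simp add: mult_ac)
    qed
    then show ?thesis unfolding s by (simp add: S_def)
  qed
  then have "walk_series (attach G1 G2 ?g) (e1, ?g e1) (e1, e2) = S e1 * walk_series G2 (?g e1) e2"
    by (intro walk_series_attach[OF G]) (use V in auto)
  then have "walk_series (attach G1 G2 ?g) (e1, e2) (e1, e2) = K * mf * me * inverse D"
    by (simp add: S_def me_def mult_ac)
  then have "walk_series (attach G1 G2 ?g) (e1, e2) (e1, e2) * D = K * mf * me * (inverse D * D)"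
    by (simp add: mult_ac)
  then show ?thesis by (simp add: D) (simp add: D_def)
qed

section \<open>Walks in a disjoint union\<close>

lemma image_eq_doubleton_iff: "inj f \<Longrightarrow> f ` E = {f x, f y} \<longleftrightarrow> E = {x, y}"
  using inj_image_eq_iff[of f E "{x, y}"] by simp

lemma adj_disjoint_union [simp]:
  "adj (disjoint_union G H) (Inl x) (Inl y) = adj G x y"
  "adj (disjoint_union G H) (Inr a) (Inr b) = adj H a b"
  "adj (disjoint_union G H) (Inl x) (Inr b) = 0"
  "adj (disjoint_union G H) (Inr a) (Inl y) = 0"
proof -
  let ?U = "disjoint_union G H"
  have "{k\<in>edges ?U. ends ?U k = {Inl x, Inl y}} = Inl ` {k\<in>edges G. ends G k = {x, y}}"
    by (auto simp: disjoint_union_def image_eq_doubleton_iff)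
  then show "adj ?U (Inl x) (Inl y) = adj G x y" by (simp add: adj_def card_image)
  have "{k\<in>edges ?U. ends ?U k = {Inr a, Inr b}} = Inr ` {k\<in>edges H. ends H k = {a, b}}"
    by (auto simp: disjoint_union_def image_eq_doubleton_iff)
  then show "adj ?U (Inr a) (Inr b) = adj H a b" by (simp add: adj_def card_image)
  have lr: "{k\<in>edges ?U. ends ?U k = {Inl x, Inr b}} = {}"
    by (auto simp: disjoint_union_def)
  show "adj ?U (Inl x) (Inr b) = 0" unfolding adj_def lr by simp
  have rl: "{k\<in>edges ?U. ends ?U k = {Inr a, Inl y}} = {}"
    by (auto simp: disjoint_union_def)
  show "adj ?U (Inr a) (Inl y) = 0" unfolding adj_def rl by simp
qed

lemma verts_disjoint_union: "verts (disjoint_union G H) = verts G <+> verts H"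
  by (simp add: disjoint_union_def)

lemma locally_finite_disjoint_union:
  assumes "locally_finite G" "locally_finite H"
  shows "locally_finite (disjoint_union G H)"
  unfolding locally_finite_def
proof
  fix p assume p: "p \<in> verts (disjoint_union G H)"
  show "finite {k\<in>edges (disjoint_union G H). p \<in> ends (disjoint_union G H) k}"
  proof (cases p)
    case (Inl x)
    have "{k\<in>edges (disjoint_union G H). p \<in> ends (disjoint_union G H) k}
        \<subseteq> Inl ` {k\<in>edges G. x \<in> ends G k}"
      by (auto simp: disjoint_union_def Inl)
    then show ?thesis
      by (rule finite_subset) (use p Inl assms in \<open>auto simp: locally_finite_def verts_disjoint_union\<close>)
  next
    case (Inr y)
    have "{k\<in>edges (disjoint_union G H). p \<in> ends (disjoint_union G H) k}
        \<subseteq> Inr ` {k\<in>edges H. y \<in> ends H k}"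
      by (auto simp: disjoint_union_def Inr)
    then show ?thesis
      by (rule finite_subset) (use p Inr assms in \<open>auto simp: locally_finite_def verts_disjoint_union\<close>)
  qed
qed

lemma neighbours_disjoint_union:
  "neighbours (disjoint_union G H) (Inl x) = Inl ` neighbours G x"
  "neighbours (disjoint_union G H) (Inr y) = Inr ` neighbours H y"
  by (auto simp: neighbours_def verts_disjoint_union)

text \<open>The resolvent vector of one summand, extended by zero to the other, solves the resolvent equation of
  the union.\<close>

lemma walk_series_disjoint_union_Inl:
  assumes "locally_finite G" "locally_finite H" "x \<in> verts G"
  shows "walk_series (disjoint_union G H) (Inl e) (Inl x) = walk_series G e x"
proof -
  have "solves_resolvent (disjoint_union G H) (Inl e) (case_sum (walk_series G e) (\<lambda>_. 0))"
    (is "solves_resolvent _ _ ?R")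
    unfolding solves_resolvent_def
  proof
    fix p assume p: "p \<in> verts (disjoint_union G H)"
    show "?R p = (if p = Inl e then 1 else 0)
        + fps_X * (\<Sum>q\<in>neighbours (disjoint_union G H) p. of_nat (adj (disjoint_union G H) p q) * ?R q)"
    proof (cases p)
      case (Inl z)
      then have "z \<in> verts G" using p by (auto simp: verts_disjoint_union)
      then have "walk_series G e z = (if z = e then 1 else 0)
          + fps_X * (\<Sum>y\<in>neighbours G z. of_nat (adj G z y) * walk_series G e y)"
        using walk_series_solves_resolvent[OF assms(1), of e] unfolding solves_resolvent_def by blast
      then show ?thesis by (simp add: Inl neighbours_disjoint_union sum.reindex)
    next
      case (Inr z)
      then show ?thesis by (simp add: neighbours_disjoint_union sum.reindex)
    qed
  qed
  from solves_resolvent_unique[OF locally_finite_disjoint_union[OF assms(1,2)] this, of "Inl x"]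
  show ?thesis using assms(3) by (simp add: verts_disjoint_union InlI InrI)
qed

lemma walk_series_disjoint_union_Inr:
  assumes "locally_finite G" "locally_finite H" "y \<in> verts H"
  shows "walk_series (disjoint_union G H) (Inr f) (Inr y) = walk_series H f y"
proof -
  have "solves_resolvent (disjoint_union G H) (Inr f) (case_sum (\<lambda>_. 0) (walk_series H f))"
    (is "solves_resolvent _ _ ?R")
    unfolding solves_resolvent_def
  proof
    fix p assume p: "p \<in> verts (disjoint_union G H)"
    show "?R p = (if p = Inr f then 1 else 0)
        + fps_X * (\<Sum>q\<in>neighbours (disjoint_union G H) p. of_nat (adj (disjoint_union G H) p q) * ?R q)"
    proof (cases p)
      case (Inr z)
      then have "z \<in> verts H" using p by (auto simp: verts_disjoint_union)
      then have "walk_series H f z = (if z = f then 1 else 0)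
          + fps_X * (\<Sum>y\<in>neighbours H z. of_nat (adj H z y) * walk_series H f y)"
        using walk_series_solves_resolvent[OF assms(2), of f] unfolding solves_resolvent_def by blast
      then show ?thesis by (simp add: Inr neighbours_disjoint_union sum.reindex)
    next
      case (Inl z)
      then show ?thesis by (simp add: neighbours_disjoint_union sum.reindex)
    qed
  qed
  from solves_resolvent_unique[OF locally_finite_disjoint_union[OF assms(1,2)] this, of "Inr y"]
  show ?thesis using assms(3) by (simp add: verts_disjoint_union InlI InrI)
qed

section \<open>From walk series to convolutions\<close>

text \<open>\<open>F_compose\<close> substitutes into a Laurent series with a pole; inverting after the substitution
  instead leaves a composition of power series, which is what the walk series provide.\<close>

lemma F_compose_eq:
  "F_compose \<mu> \<nu> = inverse (fps_to_fls (cauchy_transform \<mu> oo cauchy_transform \<nu>))"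
proof -
  have "cauchy_transform \<nu> $ 0 = 0" "cauchy_transform \<nu> $ 1 = 1"
    by (simp_all add: cauchy_transform_def)
  moreover from this have "cauchy_transform \<nu> \<noteq> 0" by auto
  ultimately show ?thesis
    by (simp add: F_compose_def F_transform_def fls_compose_fps_inverse)
qed

lemma monotone_conv_eqI:
  assumes "cauchy_transform \<nu> = cauchy_transform \<nu>1 oo cauchy_transform \<nu>2"
  shows "\<nu> = monotone_conv \<nu>1 \<nu>2"
  by (rule F_transform_inject)
     (simp only: F_transform_monotone_conv F_compose_eq F_transform_def[of \<nu>] assms)

text \<open>The hypothesis \<open>eq\<close> is \<open>1/m = 1/k + 1/a - 1/b\<close> with denominators cleared. Dividing this by \<open>t\<close>
  gives the relation between F-transforms that defines the c-monotone convolution.\<close>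

lemma cmonotone_conv_eqI:
  fixes k m a b :: "complex fps"
  assumes \<mu>: "cauchy_transform \<mu> = fps_X * m"
    and k: "cauchy_transform \<mu>1 oo cauchy_transform \<nu>2 = fps_X * k"
    and a: "cauchy_transform \<mu>2 = fps_X * a" and b: "cauchy_transform \<nu>2 = fps_X * b"
    and nz: "k \<noteq> 0" "a \<noteq> 0" "b \<noteq> 0"
    and eq: "m * (b * a - k * a + k * b) = k * b * a"
  shows "\<mu> = cmonotone_conv \<mu>1 \<nu>2 \<mu>2"
proof (rule F_transform_inject)
  have m: "m \<noteq> 0" using eq nz by auto
  let ?m = "fps_to_fls m" and ?k = "fps_to_fls k" and ?a = "fps_to_fls a" and ?b = "fps_to_fls b"
  have "?m * (?b * ?a - ?k * ?a + ?k * ?b) = ?k * ?b * ?a"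
    using arg_cong[OF eq, of fps_to_fls]
    by (simp add: fls_times_fps_to_fls fps_to_fls_plus fps_to_fls_minus)
  then have inv: "inverse ?m = inverse ?k + inverse ?a - inverse ?b"
    using m nz by (simp add: field_simps)
  show "F_transform \<mu> = F_transform (cmonotone_conv \<mu>1 \<nu>2 \<mu>2)"
    unfolding F_transform_cmonotone_conv F_compose_eq k
    by (simp only: F_transform_def \<mu> a b fls_times_fps_to_fls inverse_mult_distrib inv
        distrib_left right_diff_distrib)
qed

theorem corollary4p3:
  fixes G1 :: "('v, 'k) mgraph" and e1 f1 :: 'v
    and G2 :: "('w, 'l) mgraph" and e2 f2 :: 'w
    and \<mu>1 \<nu>1 \<mu>2 \<nu>2 :: distribution
  assumes "birooted_graph (G1, e1, f1)" and "birooted_graph (G2, e2, f2)"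
    and "\<mu>1 = spectral_distribution G1 e1" and "\<nu>1 = spectral_distribution G1 f1"
    and "\<mu>2 = spectral_distribution G2 e2" and "\<nu>2 = spectral_distribution G2 f2"
  shows "birooted_spectral_distribution (c_comb_product (G1, e1, f1) (G2, e2, f2))
           = (cmonotone_conv \<mu>1 \<nu>2 \<mu>2, monotone_conv \<nu>1 \<nu>2)"
proof -
  let ?G = "attach G1 G2 (\<lambda>x. if x = e1 then e2 else f2)"
  let ?H = "attach G1 G2 (\<lambda>x. f2)"
  let ?U = "disjoint_union ?G ?H"
  have lf: "locally_finite G1" "locally_finite G2"
    and V: "e1 \<in> verts G1" "f1 \<in> verts G1" "e2 \<in> verts G2" "f2 \<in> verts G2"
    using assms(1,2) by (auto simp: birooted_graph_def locally_finite_if_uniformly)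
  let ?me = "walk_series G2 e2 e2" and ?mf = "walk_series G2 f2 f2"
  have C: "cauchy_transform \<mu>1 = fps_X * walk_series G1 e1 e1"
      "cauchy_transform \<nu>1 = fps_X * walk_series G1 f1 f1"
      "cauchy_transform \<mu>2 = fps_X * ?me" "cauchy_transform \<nu>2 = fps_X * ?mf"
    using V assms(3-6) by (simp_all add: cauchy_transform_spectral)
  have CG: "cauchy_transform (spectral_distribution ?U (Inl (e1, e2)))
      = fps_X * walk_series ?G (e1, e2) (e1, e2)"
    using V lf by (simp add: cauchy_transform_spectral verts_disjoint_union verts_attach
        locally_finite_attach InlI InrI
        walk_series_disjoint_union_Inl)
  have CH: "cauchy_transform (spectral_distribution ?U (Inr (f1, f2)))
      = fps_X * walk_series ?H (f1, f2) (f1, f2)"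
    using V lf by (simp add: cauchy_transform_spectral verts_disjoint_union verts_attach
        locally_finite_attach InlI InrI
        walk_series_disjoint_union_Inr)
  have "spectral_distribution ?U (Inr (f1, f2)) = monotone_conv \<nu>1 \<nu>2"
  proof (rule monotone_conv_eqI)
    show "cauchy_transform (spectral_distribution ?U (Inr (f1, f2)))
        = cauchy_transform \<nu>1 oo cauchy_transform \<nu>2"
      unfolding CH C walk_series_comb_root[OF lf V(2,4)]
      by (simp add: fps_compose_mult_distrib mult_ac)
  qed
  moreover have "spectral_distribution ?U (Inl (e1, e2)) = cmonotone_conv \<mu>1 \<nu>2 \<mu>2"
  proof (rule cmonotone_conv_eqI[OF CG _ C(3,4)])
    let ?K = "(walk_series G1 e1 e1 oo (fps_X * ?mf)) * ?mf"
    show "cauchy_transform \<mu>1 oo cauchy_transform \<nu>2 = fps_X * ?K"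
      unfolding C by (simp add: fps_compose_mult_distrib mult_ac)
    have "?K $ 0 \<noteq> 0" "?me $ 0 \<noteq> 0" "?mf $ 0 \<noteq> 0"
      by (simp_all add: fps_mult_nth_0 walk_series_root_nth_0)
    then show "?K \<noteq> 0" "?me \<noteq> 0" "?mf \<noteq> 0" by fastforce+
    show "walk_series ?G (e1, e2) (e1, e2) * (?mf * ?me - ?K * ?me + ?K * ?mf) = ?K * ?mf * ?me"
      by (rule walk_series_comb_at_root[OF lf V(1,3,4)])
  qed
  ultimately show ?thesis
    by (simp add: birooted_spectral_distribution_def c_comb_product_def comb_product_def
        comb_product_at_def)
qed

end
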